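(* There is an efficient $(1-o(1))$-competitive algorithm for threshold testing with multiple tests per box and a continuous distribution. That is, there is an efficient algorithm in the multiple-tests model and a function $\varepsilon(n)\to0$ such that for every continuous distribution $F$ on $\mathbb{R}_{\ge0}$ with finite expectation and every $n$, $\mathbb{E}[X_\sigma]\ge(1-\varepsilon(n))\cdot\mathbb{E}[\max\{X_1,\dots,X_n\}]$.
   Context: Threshold testing with multiple tests per box: A distribution $F$ on $\mathbb{R}_{\ge0}$ with finite expectation is known. There are $n$ boxes; box $i$ contains a hidden value $X_i$, where $X_1,\dots,X_n$ are drawn once upfront i.i.d.\ from $F$ (all tests on the same box refer to this single value). The algorithm has a total budget of $n$ threshold tests, and each box may be tested an arbitrary number of times (with possibly different thresholds) as long as tests remain. A test of box $i$ with threshold $t\ge0$ reveals only whether $X_i\ge t$ or not. Tests may be chosen adaptively based on all previous outcomes. At the end, the algorithm chooses a box $\sigma$ and receives $X_\sigma$. An algorithm is $c$-competitive if $\mathbb{E}[X_\sigma]\ge c\cdot\mathbb{E}[\max\{X_1,\dots,X_n\}]$. *)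

theory Defs
  imports "HOL-Probability.Probability" "HOL-Computational_Algebra.Polynomial"
begin

definition nonneg_continuous_dist :: "real measure \<Rightarrow> bool" where
  "nonneg_continuous_dist F \<longleftrightarrow>
     real_distribution F \<and> (AE y in F. 0 \<le> y) \<and> continuous_on UNIV (cdf F) \<and>
     integrable F (\<lambda>y. y)"

definition quantile :: "real measure \<Rightarrow> real \<Rightarrow> real" where
  "quantile F q = Inf {y. q \<le> cdf F y}"

text \<open>
  Algorithms are structured programs of a real RAM: registers for natural numbers, used for
  counting and (indirect) addressing, and registers for real numbers, with arithmetic and exact
  comparisons of reals but no rounding. There is no multiplication of natural numbers, so
  that \<open>T\<close> steps produce numbers of \<open>O(T)\<close> bits only. The known distribution is
  accessible through an oracle for its quantile function, and the hidden values
  are accessible through threshold tests only.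
\<close>

datatype nexp = NConst nat | NReg nexp | NAdd nexp nexp | NSub nexp nexp

datatype rexp = RReg nexp | RNat nexp | RAdd rexp rexp | RSub rexp rexp
  | RMul rexp rexp | RDiv rexp rexp

datatype bexp = NLess nexp nexp | RLess rexp rexp | Neg bexp | Conj bexp bexp

datatype prog =
    Skip
  | NAssign nexp nexp
  | RAssign nexp rexp
  | Quantile nexp rexp
  | Test nexp nexp rexp
  | Seq prog prog
  | Cond bexp prog prog
  | While bexp prog

record state =
  nreg :: "nat \<Rightarrow> nat"
  rreg :: "nat \<Rightarrow> real"

fun nval :: "nexp \<Rightarrow> state \<Rightarrow> nat" where
  "nval (NConst k) s = k"
| "nval (NReg a) s = nreg s (nval a s)"
| "nval (NAdd a b) s = nval a s + nval b s"
| "nval (NSub a b) s = nval a s - nval b s"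

fun rval :: "rexp \<Rightarrow> state \<Rightarrow> real" where
  "rval (RReg a) s = rreg s (nval a s)"
| "rval (RNat a) s = real (nval a s)"
| "rval (RAdd a b) s = rval a s + rval b s"
| "rval (RSub a b) s = rval a s - rval b s"
| "rval (RMul a b) s = rval a s * rval b s"
| "rval (RDiv a b) s = rval a s / rval b s"

fun bval :: "bexp \<Rightarrow> state \<Rightarrow> bool" where
  "bval (NLess a b) s \<longleftrightarrow> nval a s < nval b s"
| "bval (RLess a b) s \<longleftrightarrow> rval a s < rval b s"
| "bval (Neg b) s \<longleftrightarrow> \<not> bval b s"
| "bval (Conj b c) s \<longleftrightarrow> bval b s \<and> bval c s"

definition nupd :: "nexp \<Rightarrow> nat \<Rightarrow> state \<Rightarrow> state" where
  "nupd a v s = s\<lparr>nreg := (nreg s)(nval a s := v)\<rparr>"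

definition rupd :: "nexp \<Rightarrow> real \<Rightarrow> state \<Rightarrow> state" where
  "rupd a v s = s\<lparr>rreg := (rreg s)(nval a s := v)\<rparr>"

text \<open>
  \<open>exec n Q x c s t k s'\<close>: for \<open>n\<close> boxes with hidden values \<open>x 0, \<dots>, x (n - 1)\<close> and
  quantile oracle \<open>Q\<close>, the program \<open>c\<close> started in \<open>s\<close> terminates in \<open>s'\<close> after \<open>t\<close> steps,
  having made \<open>k\<close> tests. Expressions are evaluated at no cost, since their sizes are constants
  of the program. An oracle query outside \<open>(0, 1)\<close>, a test of a nonexistent box and a test with a
  negative threshold are stuck.
\<close>

inductive exec ::
  "nat \<Rightarrow> (real \<Rightarrow> real) \<Rightarrow> (nat \<Rightarrow> real) \<Rightarrow> prog \<Rightarrow> state \<Rightarrow> nat \<Rightarrow> nat \<Rightarrow> state \<Rightarrow> bool"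
  for n :: nat and Q :: "real \<Rightarrow> real" and x :: "nat \<Rightarrow> real" where
  Skip: "exec n Q x Skip s 1 0 s"
| NAssign: "exec n Q x (NAssign a e) s 1 0 (nupd a (nval e s) s)"
| RAssign: "exec n Q x (RAssign a e) s 1 0 (rupd a (rval e s) s)"
| Quantile: "0 < rval e s \<Longrightarrow> rval e s < 1 \<Longrightarrow>
    exec n Q x (Quantile a e) s 1 0 (rupd a (Q (rval e s)) s)"
| Test: "nval i s < n \<Longrightarrow> 0 \<le> rval e s \<Longrightarrow>
    exec n Q x (Test a i e) s 1 1 (nupd a (if rval e s \<le> x (nval i s) then 1 else 0) s)"
| Seq: "exec n Q x c s t k s' \<Longrightarrow> exec n Q x d s' t' k' s'' \<Longrightarrow>
    exec n Q x (Seq c d) s (t + t') (k + k') s''"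
| CondTrue: "bval b s \<Longrightarrow> exec n Q x c s t k s' \<Longrightarrow>
    exec n Q x (Cond b c d) s (Suc t) k s'"
| CondFalse: "\<not> bval b s \<Longrightarrow> exec n Q x d s t k s' \<Longrightarrow>
    exec n Q x (Cond b c d) s (Suc t) k s'"
| WhileFalse: "\<not> bval b s \<Longrightarrow> exec n Q x (While b c) s 1 0 s"
| WhileTrue: "bval b s \<Longrightarrow> exec n Q x c s t k s' \<Longrightarrow> exec n Q x (While b c) s' t' k' s'' \<Longrightarrow>
    exec n Q x (While b c) s (Suc (t + t')) (k + k') s''"

inductive_cases exec_elims:
  "exec n Q x Skip s t k s'"
  "exec n Q x (NAssign a e) s t k s'"
  "exec n Q x (RAssign a e) s t k s'"
  "exec n Q x (Quantile a e) s t k s'"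
  "exec n Q x (Test a i e) s t k s'"
  "exec n Q x (Seq c d) s t k s'"
  "exec n Q x (Cond b c d) s t k s'"
  "exec n Q x (While b c) s t k s'"

lemma exec_deterministic:
  "exec n Q x c s t k s' \<Longrightarrow> exec n Q x c s t' k' s'' \<Longrightarrow> t' = t \<and> k' = k \<and> s'' = s'"
proof (induction arbitrary: t' k' s'' rule: exec.induct)
  case Seq
  from Seq.prems show ?case by (rule exec_elims) (use Seq.IH in blast)
next
  case CondTrue
  from CondTrue.prems show ?case by (rule exec_elims) (use CondTrue in blast)+
next
  case CondFalse
  from CondFalse.prems show ?case by (rule exec_elims) (use CondFalse in blast)+
next
  case WhileTrue
  from WhileTrue.prems show ?case by (rule exec_elims) (use WhileTrue in blast)+
qed (auto elim: exec_elims)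

text \<open>The input \<open>n\<close> and the output, the chosen box, are in natural-number register 0.\<close>

definition initial :: "nat \<Rightarrow> state" where
  "initial n = \<lparr>nreg = (\<lambda>_. 0)(0 := n), rreg = (\<lambda>_. 0)\<rparr>"

abbreviation runs :: "prog \<Rightarrow> nat \<Rightarrow> real measure \<Rightarrow> (nat \<Rightarrow> real) \<Rightarrow> nat \<Rightarrow> nat \<Rightarrow> nat \<Rightarrow> bool" where
  "runs c n F x t k b \<equiv> (\<exists>s. exec n (quantile F) x c (initial n) t k s \<and> nreg s 0 = b)"

definition threshold_testing_algorithm :: "prog \<Rightarrow> bool" where
  "threshold_testing_algorithm c \<longleftrightarrow>
     (\<forall>n\<ge>1. \<forall>F x. nonneg_continuous_dist F \<longrightarrow> (\<forall>i<n. 0 \<le> x i) \<longrightarrow>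
        (\<exists>t k b. runs c n F x t k b \<and> k \<le> n \<and> b < n))"

definition efficient :: "prog \<Rightarrow> bool" where
  "efficient c \<longleftrightarrow> (\<exists>p :: nat poly.
     \<forall>n\<ge>1. \<forall>F x. nonneg_continuous_dist F \<longrightarrow> (\<forall>i<n. 0 \<le> x i) \<longrightarrow>
        (\<exists>t k b. runs c n F x t k b \<and> t \<le> poly p n))"

definition chosen_box :: "prog \<Rightarrow> nat \<Rightarrow> real measure \<Rightarrow> (nat \<Rightarrow> real) \<Rightarrow> nat" where
  "chosen_box c n F x = (THE b. \<exists>t k. runs c n F x t k b)"

definition competitive :: "real \<Rightarrow> prog \<Rightarrow> nat \<Rightarrow> real measure \<Rightarrow> bool" where
  "competitive r c n F \<longleftrightarrow>
     (LINT x|(\<Pi>\<^sub>M i\<in>{..<n}. F). x (chosen_box c n F x))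
       \<ge> r * (LINT x|(\<Pi>\<^sub>M i\<in>{..<n}. F). Max (x ` {..<n}))"

end

theory Submission
  imports Defs
begin

text \<open>
  Let \<open>k\<close> be about the cube root of \<open>n\<close> and take \<open>k\<^sup>2\<close> thresholds cutting the top quantile range
  of mass \<open>k / n\<close> into slices of mass \<open>1 / (k n)\<close>. Go through the first \<open>n - k\<^sup>2\<close> boxes, testing the
  current box against the lowest threshold not yet exceeded: a failure moves on to the next box, and
  a success makes the current box the favourite and raises the threshold. Since there are at most
  \<open>n - k\<^sup>2\<close> failures and \<open>k\<^sup>2\<close> successes, the budget is never exceeded.

  The favourite is the argmax whenever the argmax is among the tested boxes and alone in its slice.
  Conditioned on the slice of the maximum, this fails with probability \<open>O(1 / k)\<close>. Conditioning on the
  slice, rather than bounding the overall failure probability, makes the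
  argument independent of the tail of the distribution.
\<close>

section \<open>The staircase process\<close>

text \<open>The triple holds the current box, the lowest threshold not yet exceeded and the
  favourite. After a success the box stays current and faces the next threshold. Terminal states are
  fixed points, so surplus iterations do no harm.\<close>

definition stair_step ::
  "nat \<Rightarrow> nat \<Rightarrow> (nat \<Rightarrow> real) \<Rightarrow> (nat \<Rightarrow> real) \<Rightarrow> nat \<times> nat \<times> nat \<Rightarrow> nat \<times> nat \<times> nat" where
  "stair_step m M \<tau> x = (\<lambda>(i, j, b).
     if j < M \<and> i < m then (if \<tau> j \<le> x i then (i, Suc j, i) else (Suc i, j, b)) else (i, j, b))"

definition staircase_box ::
  "nat \<Rightarrow> nat \<Rightarrow> nat \<Rightarrow> (nat \<Rightarrow> real) \<Rightarrow> (nat \<Rightarrow> real) \<Rightarrow> nat" where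
  "staircase_box n m M \<tau> x = snd (snd ((stair_step m M \<tau> x ^^ n) (0, 0, 0)))"

text \<open>Boxes already passed failed at a threshold no higher than \<open>\<tau> j\<close>, hence
  fail \<open>\<tau> j\<close> as well; the favourite is the box that passed the last exceeded
  threshold. The guard \<open>j < M\<close> reflects that \<open>\<tau>\<close> is controlled only
  below \<open>M\<close>.\<close>

definition step_inv :: "nat \<Rightarrow> nat \<Rightarrow> (nat \<Rightarrow> real) \<Rightarrow> (nat \<Rightarrow> real) \<Rightarrow> nat \<times> nat \<times> nat \<Rightarrow> bool" where
  "step_inv m M \<tau> x = (\<lambda>(i, j, b).
     i \<le> m \<and> j \<le> M \<and> (j < M \<longrightarrow> (\<forall>l<i. x l < \<tau> j)) \<and> (0 < j \<longrightarrow> \<tau> (j - 1) \<le> x b \<and> b < m))"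

lemma step_inv_step:
  assumes "mono_on {..<M} \<tau>" "step_inv m M \<tau> x s"
  shows "step_inv m M \<tau> x (stair_step m M \<tau> x s)"
proof -
  obtain i j b where s: "s = (i, j, b)"
    by (cases s)
  have "x l < \<tau> (Suc j)" if "x l < \<tau> j" "Suc j < M" for l
    using that mono_onD[OF assms(1), of j "Suc j"] by simp
  then show ?thesis
    using assms(2) by (auto simp: s step_inv_def stair_step_def less_Suc_eq)
qed

lemma step_inv_funpow:
  assumes "mono_on {..<M} \<tau>"
  shows "step_inv m M \<tau> x ((stair_step m M \<tau> x ^^ t) (0, 0, 0))"
  by (induction t) (use step_inv_step[OF assms] in \<open>auto simp: step_inv_def\<close>)

text \<open>Every active step raises \<open>i + j\<close> by one. As \<open>i \<le> m\<close> and
  \<open>j \<le> M\<close>, the process has become terminal after \<open>m + M\<close>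
  steps.\<close>

lemma stair_step_progress:
  "(case (stair_step m M \<tau> x ^^ t) (0, 0, 0) of (i, j, b) \<Rightarrow> i + j = t \<or> j \<ge> M \<or> i \<ge> m)"
  by (induction t) (auto simp: stair_step_def split: prod.splits)

text \<open>Box \<open>a\<close> cannot be passed while the threshold is at most
  \<open>\<tau> c\<close>, so the process ends with \<open>c < j\<close>, whether it runs out of
  boxes or of thresholds. The favourite then reaches \<open>\<tau> (j - 1) \<ge> \<tau> c\<close>,
  which only \<open>a\<close> does.\<close>

lemma staircase_box_eqI:
  assumes mono: "mono_on {..<M} \<tau>"
    and "m + M \<le> n" "a < m" "c < M" "\<tau> c \<le> x a"
    and others: "\<And>i. i < m \<Longrightarrow> i \<noteq> a \<Longrightarrow> x i < \<tau> c"
  shows "staircase_box n m M \<tau> x = a"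
proof (rule ccontr)
  obtain i j b where s: "(stair_step m M \<tau> x ^^ n) (0, 0, 0) = (i, j, b)"
    by (metis prod_cases3)
  assume "staircase_box n m M \<tau> x \<noteq> a"
  then have b: "b \<noteq> a"
    by (simp add: staircase_box_def s)
  have inv: "step_inv m M \<tau> x (i, j, b)"
    using step_inv_funpow[OF mono, of m x n] by (simp add: s)
  have "j = M \<or> i = m"
    using stair_step_progress[where t = n and m = m and M = M and \<tau> = \<tau> and x = x]
      inv \<open>m + M \<le> n\<close> \<open>c < M\<close>
    unfolding s step_inv_def by auto
  then have "c < j"
  proof
    assume "i = m"
    show ?thesis
    proof (rule ccontr)
      assume "\<not> c < j"
      then have "j \<le> c" by simp
      then have "x a < \<tau> j"
        using inv \<open>i = m\<close> \<open>a < m\<close> \<open>c < M\<close> by (auto simp: step_inv_def)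
      then show False
        using mono_onD[OF mono, of j c] \<open>j \<le> c\<close> \<open>c < M\<close> \<open>\<tau> c \<le> x a\<close> by simp
    qed
  qed (use \<open>c < M\<close> in simp)
  then have "\<tau> c \<le> \<tau> (j - 1)" "\<tau> (j - 1) \<le> x b" "b < m"
    using inv by (auto simp: step_inv_def intro!: mono_onD[OF mono])
  then show False
    using others[of b] b by simp
qed

lemma snd_step_funpow_less:
  "0 < n \<Longrightarrow> m \<le> n \<Longrightarrow> snd (snd ((stair_step m M \<tau> x ^^ t) (0, 0, 0))) < n"
  by (induction t) (auto simp: stair_step_def split: prod.splits)

lemma staircase_box_less: "0 < n \<Longrightarrow> m \<le> n \<Longrightarrow> staircase_box n m M \<tau> x < n"
  by (simp add: staircase_box_def snd_step_funpow_less)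

section \<open>Expected values\<close>

lemma measurable_staircase_box:
  assumes [simp]: "sets F = sets borel" and "m \<le> n"
  shows "staircase_box n m M \<tau> \<in> (\<Pi>\<^sub>M i\<in>{..<n}. F) \<rightarrow>\<^sub>M count_space UNIV"
proof -
  let ?P = "\<Pi>\<^sub>M i\<in>{..<n}. F"
  have step: "(\<lambda>x. stair_step m M \<tau> x s) \<in> ?P \<rightarrow>\<^sub>M count_space UNIV" for s
  proof -
    obtain i j b where s: "s = (i, j, b)"
      by (cases s)
    show ?thesis
    proof (cases "j < M \<and> i < m")
      case True
      then have "i \<in> {..<n}"
        using \<open>m \<le> n\<close> by simp
      then have "(\<lambda>x. x i) \<in> ?P \<rightarrow>\<^sub>M F"
        by (rule measurable_component_singleton)
      then have [measurable]: "(\<lambda>x. x i) \<in> borel_measurable ?P"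
        by (simp cong: measurable_cong_sets)
      show ?thesis
        using True by (simp add: s stair_step_def)
    qed (auto simp: s stair_step_def)
  qed
  have "(\<lambda>x. (stair_step m M \<tau> x ^^ t) (0, 0, 0)) \<in> ?P \<rightarrow>\<^sub>M count_space UNIV" for t
  proof (induction t)
    case (Suc t)
    \<comment> \<open>There are countably many states, so inserting the random state into the step
      preserves measurability.\<close>
    have "(\<lambda>x. stair_step m M \<tau> x ((stair_step m M \<tau> x ^^ t) (0, 0, 0)))
        \<in> ?P \<rightarrow>\<^sub>M count_space UNIV"
      by (rule measurable_compose_countable[where f = "\<lambda>s x. stair_step m M \<tau> x s", OF step Suc])
    then show ?case by simp
  qed simp
  from measurable_compose[OF this measurable_count_space[of "\<lambda>s. snd (snd s)"]]
  show ?thesis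
    unfolding staircase_box_def[abs_def] .
qed

text \<open>Only the masses strictly below the thresholds enter, strictly because a test fails when
  \<open>x i < \<tau> j\<close>. Continuity of the distribution serves later to prescribe these
  masses exactly. The value \<open>q M = 1\<close> belongs to a fictitious threshold at
  infinity.\<close>

locale thresholds = real_distribution F for F :: "real measure" +
  fixes M :: nat and \<tau> q :: "nat \<Rightarrow> real"
  assumes AE_nonneg: "AE y in F. 0 \<le> y"
    and integrable: "integrable F (\<lambda>y. y)"
    and mono: "mono_on {..<M} \<tau>"
    and prob_less: "\<And>j. j < M \<Longrightarrow> prob {..<\<tau> j} = q j"
    and q_top: "q M = 1"
    and M_pos: "0 < M"
begin

definition lower :: "nat \<Rightarrow> real set" where
  "lower j = (if j < M then {..<\<tau> j} else UNIV)"

definition bucket :: "nat \<Rightarrow> real set" where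
  "bucket b = lower (Suc b) - lower b"

text \<open>This is a first moment, not a probability. It stays unevaluated throughout, so the tail
  of the distribution never has to be estimated.\<close>

definition bucket_mass :: "nat \<Rightarrow> real" where
  "bucket_mass b = (LINT y|F. y * indicator (bucket b) y)"

text \<open>Two choices of \<open>c\<close> matter. With \<open>c = b\<close> box \<open>a\<close>
  is alone at or above its slice, which forces the algorithm to choose it if it is among the tested
  boxes; with \<open>c = Suc b\<close> no box lies above the slice of \<open>a\<close>, as is the
  case for the maximum.\<close>

definition cell :: "nat \<Rightarrow> nat \<Rightarrow> nat \<Rightarrow> nat \<Rightarrow> (nat \<Rightarrow> real) \<Rightarrow> real" where
  "cell n a b c x =
     x a * indicator (bucket b) (x a) * (\<Prod>i\<in>{..<n} - {a}. indicator (lower c) (x i))"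

abbreviation P :: "nat \<Rightarrow> (nat \<Rightarrow> real) measure" where
  "P n \<equiv> \<Pi>\<^sub>M i\<in>{..<n}. F"

lemma lower_mono: "i \<le> j \<Longrightarrow> lower i \<subseteq> lower j"
  using mono_onD[OF mono, of i j] by (auto simp: lower_def)

lemma lower_down: "y \<in> lower j \<Longrightarrow> z \<le> y \<Longrightarrow> z \<in> lower j"
  by (auto simp: lower_def split: if_splits)

lemma lower_borel [measurable]: "lower j \<in> sets borel"
  and bucket_borel [measurable]: "bucket j \<in> sets borel"
  by (auto simp: lower_def bucket_def)

lemma prob_lower: "j \<le> M \<Longrightarrow> prob (lower j) = q j"
  using prob_less[of j] q_top prob_space by (cases "j = M") (auto simp: lower_def)

lemma sum_bucket: "(\<Sum>b<M. indicator (bucket b) y) = (indicator (- lower 0) y :: real)"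
proof -
  have "(\<Sum>b<M. indicator (bucket b) y) =
      (\<Sum>b<M. indicator (lower (Suc b)) y - (indicator (lower b) y :: real))"
    unfolding bucket_def
    by (intro sum.cong refl) (use lower_mono[OF le_SucI, OF order_refl] in \<open>auto simp: indicator_def\<close>)
  also have "\<dots> = indicator (lower M) y - indicator (lower 0) y"
    by (rule sum_lessThan_telescope)
  finally show ?thesis
    by (auto simp: lower_def indicator_def)
qed

text \<open>A cell is a product of functions of single coordinates, so independence splits the
  integral: coordinate \<open>a\<close> gives \<open>bucket_mass b\<close>, each of the other
  \<open>n - 1\<close> gives \<open>q c\<close>.\<close>

lemma
  assumes "a < n" "c \<le> M"
  shows integrable_cell: "integrable (P n) (cell n a b c)"
    and integral_cell: "(LINT x|P n. cell n a b c x) = bucket_mass b * q c ^ (n - 1)"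
proof -
  interpret prod: product_prob_space "\<lambda>_. F" "{..<n}" ..
  define f where
    "f i y = (if i = a then y * indicator (bucket b) y else indicator (lower c) y :: real)" for i y
  have fa: "f a = (\<lambda>y. y * indicator (bucket b) y)"
    and fi: "i \<noteq> a \<Longrightarrow> f i = indicator (lower c)" for i
    by (auto simp: f_def)
  have f: "integrable F (f i)" for i
    unfolding f_def by (cases "i = a")
      (auto intro!: integrable_real_mult_indicator integrable simp: less_top[symmetric])
  have cell: "cell n a b c = (\<lambda>x. \<Prod>i<n. f i (x i))"
    using assms(1) by (auto simp: cell_def f_def prod.remove[of _ a] intro!: ext prod.cong)
  show "integrable (P n) (cell n a b c)"
    unfolding cell by (rule prod.product_integrable_prod) (use f in auto)
  have "(LINT x|P n. cell n a b c x) = (\<Prod>i<n. integral\<^sup>L F (f i))"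
    unfolding cell by (rule prod.product_integral_prod) (use f in auto)
  also have "\<dots> = bucket_mass b * (\<Prod>i\<in>{..<n} - {a}. integral\<^sup>L F (f i))"
    using assms(1) by (simp add: prod.remove[of _ a] fa bucket_mass_def)
  also have "(\<Prod>i\<in>{..<n} - {a}. integral\<^sup>L F (f i)) = (\<Prod>i\<in>{..<n} - {a}. q c)"
    by (intro prod.cong refl) (simp add: fi prob_lower[OF assms(2)])
  finally show "(LINT x|P n. cell n a b c x) = bucket_mass b * q c ^ (n - 1)"
    using assms(1) by simp
qed

lemma integral_cells:
  assumes "m \<le> n" "\<And>b. b < M \<Longrightarrow> c b \<le> M"
  shows "integrable (P n) (\<lambda>x. \<Sum>a<m. \<Sum>b<M. cell n a b (c b) x)"
    and "(LINT x|P n. (\<Sum>a<m. \<Sum>b<M. cell n a b (c b) x)) =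
      real m * (\<Sum>b<M. bucket_mass b * q (c b) ^ (n - 1))"
proof -
  have int: "integrable (P n) (cell n a b (c b))" if "a < m" "b < M" for a b
    using that assms by (intro integrable_cell) auto
  then show "integrable (P n) (\<lambda>x. \<Sum>a<m. \<Sum>b<M. cell n a b (c b) x)"
    by (intro Bochner_Integration.integrable_sum) auto
  have "(LINT x|P n. (\<Sum>a<m. \<Sum>b<M. cell n a b (c b) x)) =
      (\<Sum>a<m. LINT x|P n. (\<Sum>b<M. cell n a b (c b) x))"
    using int by (intro Bochner_Integration.integral_sum Bochner_Integration.integrable_sum) auto
  also have "\<dots> = (\<Sum>a<m. \<Sum>b<M. LINT x|P n. cell n a b (c b) x)"
    using int by (intro sum.cong refl Bochner_Integration.integral_sum) auto
  also have "\<dots> = (\<Sum>a<m. \<Sum>b<M. bucket_mass b * q (c b) ^ (n - 1))"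
    using assms by (intro sum.cong refl integral_cell) auto
  finally show "(LINT x|P n. (\<Sum>a<m. \<Sum>b<M. cell n a b (c b) x)) =
      real m * (\<Sum>b<M. bucket_mass b * q (c b) ^ (n - 1))"
    by simp
qed

section \<open>Nonnegativity, and integrability of the payoff and of the maximum\<close>

lemma bucket_mass_nonneg: "0 \<le> bucket_mass b"
  unfolding bucket_mass_def
  by (rule integral_nonneg_AE) (use AE_nonneg in \<open>eventually_elim, simp add: indicator_def\<close>)

lemma AE_boxes_nonneg: "AE x in P n. \<forall>i<n. 0 \<le> x i"
proof -
  have "AE x in P n. \<forall>i\<in>{..<n}. 0 \<le> x i"
    by (rule AE_finite_allI) (auto intro!: AE_PiM_component AE_nonneg prob_space_axioms)
  then show ?thesis
    by (simp only: Ball_def lessThan_iff)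
qed

lemma measurable_box [measurable]: "i < n \<Longrightarrow> (\<lambda>x. x i) \<in> borel_measurable (P n)"
  using measurable_component_singleton[of i "{..<n}" "\<lambda>_. F"] by (simp cong: measurable_cong_sets)

lemma integrable_box: "i < n \<Longrightarrow> integrable (P n) (\<lambda>x. x i)"
  by (rule integrable_distr[of "\<lambda>x. x i" "P n" F])
    (simp_all add: distr_PiM_component[of "{..<n}" "\<lambda>_. F" i] prob_space_axioms integrable)

text \<open>The sum of all \<open>\<bar>x i\<bar>\<close> is an integrable bound. This covers both
  the maximum and the value of the chosen box.\<close>

lemma integrable_if_boxes:
  assumes [measurable]: "f \<in> borel_measurable (P n)"
    and "\<And>x. \<exists>i<n. f x = x i"
  shows "integrable (P n) f"
proof (rule Bochner_Integration.integrable_bound)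
  show "integrable (P n) (\<lambda>x. \<Sum>i<n. \<bar>x i\<bar>)"
    by (intro Bochner_Integration.integrable_sum integrable_abs integrable_box) simp
  show "AE x in P n. norm (f x) \<le> norm (\<Sum>i<n. \<bar>x i\<bar>)"
  proof (intro always_eventually allI)
    fix x
    obtain i where "i < n" "f x = x i"
      using assms(2) by blast
    then have "\<bar>f x\<bar> \<le> (\<Sum>i<n. \<bar>x i\<bar>)"
      using member_le_sum[of i "{..<n}" "\<lambda>i. \<bar>x i\<bar>"] by simp
    then show "norm (f x) \<le> norm (\<Sum>i<n. \<bar>x i\<bar>)" by simp
  qed
qed simp

lemma
  assumes "1 \<le> n"
  shows Max_box: "\<And>x :: nat \<Rightarrow> real. \<exists>i<n. Max (x ` {..<n}) = x i"
    and integrable_Max: "integrable (P n) (\<lambda>x. Max (x ` {..<n}))"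
proof -
  have *: "\<exists>i<n. Max (x ` {..<n}) = x i" for x :: "nat \<Rightarrow> real"
    using Max_in[of "x ` {..<n}"] assms by fastforce
  then show "\<exists>i<n. Max (x ` {..<n}) = x i" for x :: "nat \<Rightarrow> real" .
  have "(\<lambda>x. Max ((\<lambda>i. x i) ` {..<n})) \<in> borel_measurable (P n)"
    by (rule borel_measurable_Max) auto
  then show "integrable (P n) (\<lambda>x. Max (x ` {..<n}))"
    using * by (intro integrable_if_boxes) auto
qed

lemma integrable_staircase:
  assumes "1 \<le> n" "m \<le> n"
  shows "integrable (P n) (\<lambda>x. x (staircase_box n m M \<tau> x))"
proof (rule integrable_if_boxes)
  \<comment> \<open>The guard always holds, but it makes the function measurable for every fixed
    index, including those that are no coordinate.\<close>
  have "(\<lambda>x. x (staircase_box n m M \<tau> x)) \<in> borel_measurable (P n) \<longleftrightarrow>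
      (\<lambda>x. (if staircase_box n m M \<tau> x < n then x (staircase_box n m M \<tau> x) else 0))
        \<in> borel_measurable (P n)"
    using assms by (simp add: staircase_box_less)
  also have "\<dots>"
  proof (rule measurable_compose_countable[where f = "\<lambda>i x. if i < n then x i else 0"])
    show "(\<lambda>x. if i < n then x i else 0) \<in> borel_measurable (P n)" for i
      by (cases "i < n") auto
  qed (use assms measurable_staircase_box in auto)
  finally show "(\<lambda>x. x (staircase_box n m M \<tau> x)) \<in> borel_measurable (P n)" .
  show "\<exists>i<n. x (staircase_box n m M \<tau> x) = x i" for x
    using assms staircase_box_less[of n m M \<tau> x] by auto
qed

text \<open>By \<open>staircase_box_eqI\<close> a nonzero cell must belong to the chosen box. The
  slices are disjoint, so the cells of that box sum to at most its value.\<close>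

lemma cells_le_staircase:
  assumes "m + M \<le> n" "1 \<le> n" and nonneg: "\<And>i. i < n \<Longrightarrow> 0 \<le> x i"
  shows "(\<Sum>a<m. \<Sum>b<M. cell n a b b x) \<le> x (staircase_box n m M \<tau> x)"
proof -
  define s where "s = staircase_box n m M \<tau> x"
  have s: "s < n"
    using assms by (auto simp: s_def intro!: staircase_box_less)
  have "cell n a b b x \<le> (if a = s then x s * indicator (bucket b) (x s) else 0)"
    if "a < m" "b < M" for a b
  proof (cases "x a \<in> bucket b \<and> (\<forall>i\<in>{..<n} - {a}. x i \<in> lower b)")
    case True
    have "s = a"
      unfolding s_def using True that assms(1) mono
      by (intro staircase_box_eqI[where c = b]) (auto simp: bucket_def lower_def split: if_splits)
    with True show ?thesis
      by (simp add: cell_def)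
  next
    case False
    then have "cell n a b b x = 0"
      by (force simp: cell_def)
    then show ?thesis
      using nonneg[OF s] by simp
  qed
  then have "(\<Sum>a<m. \<Sum>b<M. cell n a b b x) \<le>
      (\<Sum>a<m. \<Sum>b<M. if a = s then x s * indicator (bucket b) (x s) else 0)"
    by (intro sum_mono) auto
  also have "\<dots> = (\<Sum>a<m. if a = s then x s * indicator (- lower 0) (x s) else 0)"
    by (intro sum.cong refl) (simp add: sum_bucket flip: sum_distrib_left)
  also have "\<dots> \<le> x s"
    using nonneg[OF s] by (simp add: indicator_def)
  finally show ?thesis
    by (simp add: s_def)
qed

text \<open>The cells of a single argmax already suffice, since every box lies below the upper end
  of its slice. All other cells are nonnegative, so counting several boxes of the top slice only
  enlarges the right side.\<close>

lemma Max_le_cells: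
  assumes "1 \<le> n" and nonneg: "\<And>i. i < n \<Longrightarrow> 0 \<le> x i"
  shows "Max (x ` {..<n}) * indicator (- lower 0) (Max (x ` {..<n})) \<le>
    (\<Sum>a<n. \<Sum>b<M. cell n a b (Suc b) x)"
proof -
  obtain a where a: "a < n" "Max (x ` {..<n}) = x a"
    using Max_box[OF assms(1)] by blast
  have le: "x i \<le> x a" if "i < n" for i
    using that a(2) by (metis Max_ge finite_imageI finite_lessThan imageI lessThan_iff)
  have nn: "0 \<le> cell n a' b c x" if "a' < n" for a' b c
    using nonneg[OF that] by (auto simp: cell_def intro!: mult_nonneg_nonneg prod_nonneg)
  have "x a * indicator (- lower 0) (x a) = (\<Sum>b<M. x a * indicator (bucket b) (x a))"
    by (simp add: sum_bucket flip: sum_distrib_left)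
  also have "\<dots> \<le> (\<Sum>b<M. cell n a b (Suc b) x)"
  proof (rule sum_mono)
    fix b
    show "x a * indicator (bucket b) (x a) \<le> cell n a b (Suc b) x"
    proof (cases "x a \<in> bucket b")
      case True
      then have "x i \<in> lower (Suc b)" if "i < n" for i
        using le[OF that] lower_down by (auto simp: bucket_def)
      then show ?thesis
        by (simp add: cell_def)
    qed (simp add: cell_def)
  qed
  also have "\<dots> \<le> (\<Sum>a<n. \<Sum>b<M. cell n a b (Suc b) x)"
    using a(1) nn by (intro member_le_sum) (auto intro!: sum_nonneg)
  finally show ?thesis
    by (simp add: a(2))
qed

section \<open>Bounds on the expected payoff and the expected maximum\<close>

lemma expectation_staircase_ge:
  assumes "m + M \<le> n" "1 \<le> n"
  shows "real m * (\<Sum>b<M. bucket_mass b * q b ^ (n - 1)) \<le>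
    (LINT x|P n. x (staircase_box n m M \<tau> x))"
proof -
  have "(LINT x|P n. (\<Sum>a<m. \<Sum>b<M. cell n a b b x)) \<le>
      (LINT x|P n. x (staircase_box n m M \<tau> x))"
    using AE_boxes_nonneg[of n] assms
    by (intro integral_mono_AE integral_cells(1) integrable_staircase)
      (auto elim!: eventually_mono intro!: cells_le_staircase)
  then show ?thesis
    using assms by (subst (asm) integral_cells(2)) auto
qed

lemma prob_all_lower:
  "measure (P n) {x \<in> space (P n). \<forall>i<n. x i \<in> lower 0} = q 0 ^ n"
proof -
  interpret prod: product_prob_space "\<lambda>_. F" "{..<n}" ..
  interpret finite_product_prob_space "\<lambda>_. F" "{..<n}"
    by unfold_locales (simp only: finite_lessThan)
  have "{x \<in> space (P n). \<forall>i<n. x i \<in> lower 0} = (\<Pi>\<^sub>E i\<in>{..<n}. lower 0)"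
    by (auto simp: space_PiM PiE_def)
  then show ?thesis
    using finite_measure_PiM_emb[of "\<lambda>_. lower 0"] prob_lower[of 0] by simp
qed

text \<open>Below the lowest threshold the maximum is at most \<open>\<tau> 0\<close>, and this event has probability
  \<open>q 0 ^ n\<close>, while its complement contributes at least \<open>\<tau> 0 * (1 - q 0 ^ n)\<close>.\<close>

lemma expectation_Max_le:
  assumes "1 \<le> n"
  shows "(1 - q 0 ^ n) * (LINT x|P n. Max (x ` {..<n})) \<le>
    real n * (\<Sum>b<M. bucket_mass b * q (Suc b) ^ (n - 1))"
proof -
  interpret prod: prob_space "P n"
    by (intro prob_space_PiM prob_space_axioms)
  define Y :: "(nat \<Rightarrow> real) \<Rightarrow> real" where "Y x = Max (x ` {..<n})" for x
  define A where "A = {x \<in> space (P n). \<forall>i<n. x i \<in> lower 0}"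
  have A [measurable]: "A \<in> sets (P n)"
    unfolding A_def by measurable
  have pA: "prod.prob A = q 0 ^ n"
    unfolding A_def by (rule prob_all_lower)
  have Y: "integrable (P n) Y"
    unfolding Y_def by (rule integrable_Max[OF assms])
  have mem: "x \<in> A \<longleftrightarrow> Y x \<in> lower 0" if "x \<in> space (P n)" for x
    using that assms M_pos Max_less_iff[of "x ` {..<n}" "\<tau> 0"]
    by (auto simp: A_def Y_def lower_def lessThan_empty_iff)
  define U where "U = (LINT x|P n. Y x * indicator A x)"
  define V where "V = (LINT x|P n. Y x * indicator (space (P n) - A) x)"
  have int: "integrable (P n) (\<lambda>x. Y x * indicator A x)"
    "integrable (P n) (\<lambda>x. Y x * indicator (space (P n) - A) x)"
    using Y by (auto intro!: integrable_real_mult_indicator)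
  have int_ind: "integrable (P n) (\<lambda>x. \<tau> 0 * indicator S x)" if "S \<in> sets (P n)" for S
    using that by (auto intro!: integrable_real_mult_indicator simp: less_top[symmetric])
  have "(LINT x|P n. Y x) = (LINT x|P n. Y x * indicator A x + Y x * indicator (space (P n) - A) x)"
    by (intro Bochner_Integration.integral_cong) (auto simp: indicator_def)
  then have UV: "(LINT x|P n. Y x) = U + V"
    using int by (simp add: U_def V_def)
  have "U \<le> (LINT x|P n. \<tau> 0 * indicator A x)"
    unfolding U_def
  proof (rule integral_mono[OF int(1) int_ind[OF A]])
    show "Y x * indicator A x \<le> \<tau> 0 * indicator A x" if "x \<in> space (P n)" for x
      using mem[OF that] M_pos by (cases "x \<in> A") (auto simp: lower_def)
  qed
  then have U: "U \<le> \<tau> 0 * q 0 ^ n"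
    by (simp add: pA)
  have "(LINT x|P n. \<tau> 0 * indicator (space (P n) - A) x) \<le> V"
    unfolding V_def
  proof (rule integral_mono[OF int_ind int(2)])
    show "\<tau> 0 * indicator (space (P n) - A) x \<le> Y x * indicator (space (P n) - A) x"
      if "x \<in> space (P n)" for x
      using mem[OF that] that M_pos by (cases "x \<in> A") (auto simp: lower_def)
  qed simp
  moreover have "(LINT x|P n. \<tau> 0 * indicator (space (P n) - A) x) = \<tau> 0 * (1 - q 0 ^ n)"
    using prod.prob_compl[OF A] pA by (simp only: integral_mult_right_zero
        Bochner_Integration.integral_indicator Int_absorb2 Diff_subset)
  ultimately have V: "\<tau> 0 * (1 - q 0 ^ n) \<le> V"
    by (simp only:)
  have q: "0 \<le> q 0 ^ n" "q 0 ^ n \<le> 1"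
    using prod.prob_le_1[of A] measure_nonneg[of "P n" A] unfolding pA by blast+
  \<comment> \<open>With \<open>u = q 0 ^ n\<close>, the bounds \<open>U \<le> \<tau> 0 * u\<close>
    and \<open>\<tau> 0 * (1 - u) \<le> V\<close> give \<open>(1 - u) * U \<le> u * V\<close>, so
    \<open>\<tau> 0\<close> cancels and the sum is at most \<open>V\<close>.\<close>
  have "(1 - q 0 ^ n) * (U + V) \<le> (1 - q 0 ^ n) * (\<tau> 0 * q 0 ^ n) + (1 - q 0 ^ n) * V"
    using U q by (simp add: distrib_left mult_left_mono)
  also have "\<dots> \<le> q 0 ^ n * V + (1 - q 0 ^ n) * V"
    using mult_left_mono[OF V q(1)] by (simp add: algebra_simps)
  also have "\<dots> = V"
    by (simp add: algebra_simps)
  also have "V \<le> (LINT x|P n. (\<Sum>a<n. \<Sum>b<M. cell n a b (Suc b) x))"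
    unfolding V_def
  proof (rule integral_mono_AE[OF int(2) integral_cells(1)])
    show "AE x in P n. Y x * indicator (space (P n) - A) x \<le>
        (\<Sum>a<n. \<Sum>b<M. cell n a b (Suc b) x)"
      using AE_boxes_nonneg[of n] AE_space[of "P n"]
    proof eventually_elim
      case (elim x)
      have "indicator (space (P n) - A) x = (indicator (- lower 0) (Y x) :: real)"
        using mem[OF elim(2)] elim(2) by (auto simp: indicator_def)
      then show ?case
        using Max_le_cells[OF assms, of x] elim(1) by (simp add: Y_def)
    qed
  qed auto
  also have "\<dots> = real n * (\<Sum>b<M. bucket_mass b * q (Suc b) ^ (n - 1))"
    by (rule integral_cells(2)) auto
  finally show ?thesis
    using UV by (simp add: Y_def)
qed

end
section \<open>The program\<close>

text \<open>For \<open>n \<ge> 1\<close> this is the largest \<open>k\<close> with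
  \<open>k ^ 3 < n\<close>, which a counter can find. The \<open>k * k\<close> boxes left untested
  are then a fraction below \<open>1 / k\<close> of all boxes when \<open>k\<close> is
  positive.\<close>

definition cube_scale :: "nat \<Rightarrow> nat" where
  "cube_scale n = (LEAST k. n \<le> Suc k ^ 3)"

lemma le_scale: "n \<le> Suc (cube_scale n) ^ 3"
  unfolding cube_scale_def by (rule LeastI[of _ n]) (simp add: power3_eq_cube)

lemma less_scaleD: "k < cube_scale n \<Longrightarrow> Suc k ^ 3 < n"
  unfolding cube_scale_def using not_less_Least by force

lemma scale_cube_less:
  assumes "1 \<le> n"
  shows "cube_scale n ^ 3 < n"
  using assms less_scaleD[of "cube_scale n - 1" n] by (cases "cube_scale n") auto

lemma scale_sq_less:
  assumes "1 \<le> n"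
  shows "cube_scale n * cube_scale n < n" "cube_scale n < n"
proof -
  have "cube_scale n \<le> cube_scale n * cube_scale n" "cube_scale n * cube_scale n \<le> cube_scale n ^ 3"
    by (auto simp: power3_eq_cube)
  with scale_cube_less[OF assms] show "cube_scale n * cube_scale n < n" "cube_scale n < n"
    by linarith+
qed

abbreviation "R l \<equiv> NReg (NConst l)"

text \<open>Natural numbers cannot be multiplied, so the cube is formed from counters converted to
  reals, whose arithmetic is exact. The guard of the main loop squares the scale in the same
  way.\<close>

definition scale_loop :: prog where
  "scale_loop = While (RLess (RMul (RNat (NAdd (R 2) (NConst 1)))
      (RMul (RNat (NAdd (R 2) (NConst 1))) (RNat (NAdd (R 2) (NConst 1))))) (RNat (R 1)))
    (NAssign (NConst 2) (NAdd (R 2) (NConst 1)))"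

definition stair_guard :: bexp where
  "stair_guard = Conj (RLess (RNat (R 4)) (RMul (RNat (R 2)) (RNat (R 2))))
    (RLess (RAdd (RNat (R 3)) (RMul (RNat (R 2)) (RNat (R 2)))) (RNat (R 1)))"

definition level_exp :: rexp where
  "level_exp = RSub (RNat (NConst 1))
    (RDiv (RSub (RMul (RNat (R 2)) (RNat (R 2))) (RNat (R 4))) (RMul (RNat (R 2)) (RNat (R 1))))"

text \<open>Natural register 0 keeps the favourite, so the output is in place whenever the loop
  stops. Real register 0 is a different cell and carries the threshold.\<close>

definition stair_body :: prog where
  "stair_body =
    Seq (Quantile (NConst 0) level_exp)
   (Seq (Test (NConst 5) (R 3) (RReg (NConst 0)))
        (Cond (NLess (NConst 0) (R 5))
          (Seq (NAssign (NConst 0) (R 3)) (NAssign (NConst 4) (NAdd (R 4) (NConst 1))))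
          (NAssign (NConst 3) (NAdd (R 3) (NConst 1)))))"

text \<open>Registers 1 to 5 hold the number of boxes, the scale, the current box, the current level and
  the outcome of the last test.\<close>

definition staircase :: prog where
  "staircase =
    Seq (NAssign (NConst 1) (R 0)) (Seq (NAssign (NConst 0) (NConst 0))
      (Seq scale_loop (While stair_guard stair_body)))"

text \<open>The mass above level \<open>j\<close> falls from \<open>k / n\<close> at
  \<open>j = 0\<close> to 0 at \<open>j = k * k\<close> in equal steps of
  \<open>1 / (k * n)\<close>, where \<open>k\<close> is the scale.\<close>

definition quantile_level :: "nat \<Rightarrow> nat \<Rightarrow> real" where
  "quantile_level n j =
     1 - (real (cube_scale n * cube_scale n) - real j) / (real (cube_scale n) * real n)"

definition threshold :: "nat \<Rightarrow> real measure \<Rightarrow> nat \<Rightarrow> real" where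
  "threshold n F j = quantile F (quantile_level n j)"

text \<open>Outside the open unit interval the oracle would be stuck. The mass above the level is
  positive as \<open>j < k * k\<close>, and at most \<open>k / n < 1\<close>.\<close>

lemma quantile_level_bounds:
  assumes "1 \<le> n" "j < cube_scale n * cube_scale n"
  shows "0 < quantile_level n j" "quantile_level n j < 1"
proof -
  have k: "0 < cube_scale n"
    using assms by (cases "cube_scale n") auto
  let ?d = "real (cube_scale n * cube_scale n) - real j" and ?e = "real (cube_scale n) * real n"
  have "real (cube_scale n * cube_scale n) < ?e"
    using k scale_sq_less(2)[OF assms(1)] by simp
  moreover have "real j < real (cube_scale n * cube_scale n)"
    using assms(2) by (simp only: of_nat_less_iff)
  ultimately have "0 < ?d / ?e" "?d / ?e < 1"
    by (auto simp: divide_less_eq)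
  then show "0 < quantile_level n j" "quantile_level n j < 1"
    unfolding quantile_level_def by linarith+
qed

lemma quantile_level_mono: "i \<le> j \<Longrightarrow> quantile_level n i \<le> quantile_level n j"
  by (simp add: quantile_level_def divide_right_mono)

text \<open>Continuity makes the superlevel set closed, so its infimum belongs to it, and provides a
  point with value exactly \<open>q\<close>, which bounds the infimum from above. Nonnegativity
  keeps the later test from being stuck.\<close>

lemma cdf_quantile:
  assumes F: "nonneg_continuous_dist F" and q: "0 < q" "q < 1"
  shows "cdf F (quantile F q) = q" "0 \<le> quantile F q"
proof -
  interpret real_distribution F
    using F by (simp add: nonneg_continuous_dist_def)
  have cont: "continuous_on UNIV (cdf F)" and nn: "AE y in F. 0 \<le> y"
    using F by (auto simp: nonneg_continuous_dist_def)
  have neg: "cdf F y = 0" if "y < 0" for y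
  proof -
    have "AE z in F. z \<notin> {..y}"
      using nn by eventually_elim (use that in auto)
    then show ?thesis
      unfolding cdf_def by (subst prob_eq_0) auto
  qed
  let ?S = "{y. q \<le> cdf F y}"
  have lower: "0 \<le> y" if "y \<in> ?S" for y
    using that neg[of y] q by (cases "y < 0") auto
  have "eventually (\<lambda>y. q < cdf F y) at_top"
    using cdf_lim_at_top_prob q(2) by (rule order_tendstoD)
  then obtain y where y: "q < cdf F y"
    by (metis eventually_at_top_linorder order_refl)
  then have "0 \<le> y"
    using lower[of y] by simp
  \<comment> \<open>The interval starts at -1 because the distribution function vanishes at negative
    arguments.\<close>
  have "\<exists>z\<ge>-1. z \<le> y \<and> cdf F z = q"
    by (rule IVT') (use neg[of "-1"] q y \<open>0 \<le> y\<close> cont in \<open>auto intro: continuous_on_subset\<close>)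
  then obtain z where z: "cdf F z = q" by auto
  have bdd: "bdd_below ?S"
    using lower by (meson bdd_belowI)
  have "closed ?S"
    by (rule closed_Collect_le) (use cont in auto)
  then have "Inf ?S \<in> ?S"
    using bdd z by (intro closed_contains_Inf) auto
  moreover have "cdf F (Inf ?S) \<le> cdf F z"
    using z bdd by (intro cdf_nondecreasing cInf_lower) auto
  ultimately show "cdf F (quantile F q) = q"
    using z by (simp add: quantile_def)
  show "0 \<le> quantile F q"
    using lower \<open>Inf ?S \<in> ?S\<close> by (simp add: quantile_def)
qed

text \<open>The induction runs on the distance \<open>d\<close> of the counter from its final value:
  minimality keeps the guard true before that value, and \<open>le_scale\<close> makes it false
  there. No test occurs, so \<open>n'\<close>, \<open>Q\<close> and \<open>x\<close> are
  arbitrary.\<close>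

lemma exec_scale_loop:
  assumes "nreg s 1 = n" "nreg s 2 + d = cube_scale n"
  shows "\<exists>t s'. exec n' Q x scale_loop s t 0 s' \<and> t \<le> 2 * d + 1 \<and>
    nreg s' = (nreg s)(2 := cube_scale n)"
  using assms
proof (induction d arbitrary: s)
  case 0
  have "real n \<le> real (Suc (cube_scale n) ^ 3)"
    using le_scale[of n] by (simp only: of_nat_le_iff)
  then have "exec n' Q x scale_loop s 1 0 s"
    unfolding scale_loop_def using 0
    by (intro exec.WhileFalse) (simp add: power3_eq_cube algebra_simps)
  then show ?case
    using 0 by (intro exI[of _ 1] exI[of _ s]) auto
next
  case (Suc d)
  let ?s = "nupd (NConst 2) (nval (NAdd (R 2) (NConst 1)) s) s"
  have "\<exists>t s'. exec n' Q x scale_loop ?s t 0 s' \<and> t \<le> 2 * d + 1 \<and>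
    nreg s' = (nreg ?s)(2 := cube_scale n)"
    using Suc.prems by (intro Suc.IH) (auto simp: nupd_def)
  then obtain t s' where s': "exec n' Q x scale_loop ?s t 0 s'" "t \<le> 2 * d + 1"
    "nreg s' = (nreg ?s)(2 := cube_scale n)" by blast
  have "real (Suc (nreg s 2) ^ 3) < real n"
    using less_scaleD[of "nreg s 2" n] Suc.prems by (simp only: of_nat_less_iff)
  then have "exec n' Q x scale_loop s (Suc (1 + t)) (0 + 0) s'"
    using s'(1) Suc.prems unfolding scale_loop_def
    by (intro exec.WhileTrue[OF _ exec.NAssign]) (auto simp: power3_eq_cube algebra_simps)
  then show ?case
    using s' by (intro exI[of _ "Suc (1 + t)"] exI[of _ s']) (auto simp: nupd_def)
qed

text \<open>Register 5 and the real registers are left free, since each iteration writes what it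
  reads from them.\<close>

definition represents :: "nat \<Rightarrow> state \<Rightarrow> nat \<times> nat \<times> nat \<Rightarrow> bool" where
  "represents n s = (\<lambda>(i, j, b).
     nreg s 1 = n \<and> nreg s 2 = cube_scale n \<and> nreg s 3 = i \<and> nreg s 4 = j \<and> nreg s 0 = b)"

lemma exec_stair_body:
  assumes F: "nonneg_continuous_dist F" and "1 \<le> n" and s: "represents n s (i, j, b)"
    and ij: "j < cube_scale n * cube_scale n" "i + cube_scale n * cube_scale n < n"
  shows "\<exists>t s'. exec n (quantile F) x stair_body s t 1 s' \<and> t \<le> 5 \<and>
    represents n s' (if threshold n F j \<le> x i then (i, Suc j, i) else (Suc i, j, b))"
proof -
  have lev: "rval level_exp s = quantile_level n j"
    using s by (simp add: level_exp_def represents_def quantile_level_def)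
  note q = quantile_level_bounds[OF \<open>1 \<le> n\<close> ij(1)]
  let ?s1 = "rupd (NConst 0) (quantile F (rval level_exp s)) s"
  let ?o = "if rval (RReg (NConst 0)) ?s1 \<le> x (nval (R 3) ?s1) then 1 else 0"
  let ?s2 = "nupd (NConst 5) ?o ?s1"
  have e1: "exec n (quantile F) x (Quantile (NConst 0) level_exp) s 1 0 ?s1"
    using q by (intro exec.Quantile) (auto simp: lev)
  have e2: "exec n (quantile F) x (Test (NConst 5) (R 3) (RReg (NConst 0))) ?s1 1 1 ?s2"
    using s ij cdf_quantile(2)[OF F q]
    by (intro exec.Test) (auto simp: represents_def rupd_def lev)
  have outcome: "rval (RReg (NConst 0)) ?s1 \<le> x (nval (R 3) ?s1) \<longleftrightarrow> threshold n F j \<le> x i"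
    using s by (simp add: represents_def rupd_def lev threshold_def)
  show ?thesis
  proof (cases "threshold n F j \<le> x i")
    case True
    let ?s3 = "nupd (NConst 0) (nval (R 3) ?s2) ?s2"
    let ?s4 = "nupd (NConst 4) (nval (NAdd (R 4) (NConst 1)) ?s3) ?s3"
    have "exec n (quantile F) x stair_body s (1 + (1 + Suc (1 + 1))) (0 + (1 + (0 + 0))) ?s4"
      unfolding stair_body_def
      by (rule exec.Seq[OF e1 exec.Seq[OF e2
            exec.CondTrue[OF _ exec.Seq[OF exec.NAssign exec.NAssign]]]])
        (use outcome True in \<open>simp add: nupd_def\<close>)
    moreover have "represents n ?s4 (i, Suc j, i)"
      using s by (simp add: represents_def nupd_def rupd_def)
    ultimately show ?thesis
      using True by (intro exI[of _ 5] exI[of _ ?s4]) (simp add: numeral_eq_Suc)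
  next
    case False
    let ?s3 = "nupd (NConst 3) (nval (NAdd (R 3) (NConst 1)) ?s2) ?s2"
    have "exec n (quantile F) x stair_body s (1 + (1 + Suc 1)) (0 + (1 + 0)) ?s3"
      unfolding stair_body_def
      by (rule exec.Seq[OF e1 exec.Seq[OF e2 exec.CondFalse[OF _ exec.NAssign]]])
        (use outcome False in \<open>simp add: nupd_def\<close>)
    moreover have "represents n ?s3 (Suc i, j, b)"
      using s by (simp add: represents_def nupd_def rupd_def)
    ultimately show ?thesis
      using False by (intro exI[of _ 4] exI[of _ ?s3]) (simp add: numeral_eq_Suc)
  qed
qed

abbreviation program_step ::
  "nat \<Rightarrow> real measure \<Rightarrow> (nat \<Rightarrow> real) \<Rightarrow> nat \<times> nat \<times> nat \<Rightarrow> nat \<times> nat \<times> nat" where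
  "program_step n F x \<equiv>
     stair_step (n - cube_scale n * cube_scale n) (cube_scale n * cube_scale n) (threshold n F) x"

text \<open>The fuel \<open>d = n - i - j\<close> pays for the tests: each iteration makes one test
  and raises \<open>i + j\<close> by one. Its cost is at most 5 steps for the body and 1 for the
  guard.\<close>

lemma exec_stair_loop:
  assumes F: "nonneg_continuous_dist F" and n: "1 \<le> n"
    and "represents n s (i, j, b)" "i + j + d = n"
  shows "\<exists>t k s'. exec n (quantile F) x (While stair_guard stair_body) s t k s' \<and> k \<le> d \<and>
    t \<le> 6 * d + 1 \<and> represents n s'
      ((program_step n F x ^^ d) (i, j, b))"
  using assms(3-)
proof (induction d arbitrary: s i j b)
  case 0
  \<comment> \<open>Without fuel \<open>i + j = n\<close>, so \<open>j < k * k\<close> and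
    \<open>i + k * k < n\<close> contradict each other.\<close>
  have "\<not> (j < cube_scale n * cube_scale n \<and> i + cube_scale n * cube_scale n < n)"
    using 0 by auto
  then have "\<not> (real j < real (cube_scale n * cube_scale n) \<and>
      real (i + cube_scale n * cube_scale n) < real n)"
    by (simp only: of_nat_less_iff not_False_eq_True)
  then have "\<not> bval stair_guard s"
    using 0 by (simp add: stair_guard_def represents_def)
  then have "exec n (quantile F) x (While stair_guard stair_body) s 1 0 s"
    by (rule exec.WhileFalse)
  then show ?case
    using 0 by (intro exI[of _ 1] exI[of _ 0] exI[of _ s]) auto
next
  case (Suc d)
  let ?step = "program_step n F x"
  let ?c = "j < cube_scale n * cube_scale n \<and> i + cube_scale n * cube_scale n < n"
  have "bval stair_guard s \<longleftrightarrow>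
      real j < real (cube_scale n * cube_scale n) \<and> real (i + cube_scale n * cube_scale n) < real n"
    using Suc.prems by (simp add: stair_guard_def represents_def)
  then have guard: "bval stair_guard s \<longleftrightarrow> ?c"
    by (simp only: of_nat_less_iff)
  show ?case
  proof (cases ?c)
    case True
    obtain t s1 where s1: "exec n (quantile F) x stair_body s t 1 s1" "t \<le> 5"
      "represents n s1 (if threshold n F j \<le> x i then (i, Suc j, i) else (Suc i, j, b))"
      using exec_stair_body[OF F n Suc.prems(1)] True by blast
    define i' j' b' where "i' = (if threshold n F j \<le> x i then i else Suc i)"
      and "j' = (if threshold n F j \<le> x i then Suc j else j)"
      and "b' = (if threshold n F j \<le> x i then i else b)"
    have st: "?step (i, j, b) = (i', j', b')"
      using True by (auto simp: stair_step_def i'_def j'_def b'_def)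
    have "\<exists>t k s'. exec n (quantile F) x (While stair_guard stair_body) s1 t k s' \<and> k \<le> d \<and>
        t \<le> 6 * d + 1 \<and> represents n s' ((?step ^^ d) (i', j', b'))"
      by (rule Suc.IH) (use s1(3) Suc.prems in \<open>auto simp: i'_def j'_def b'_def split: if_splits\<close>)
    then obtain t' k' s' where s': "exec n (quantile F) x (While stair_guard stair_body) s1 t' k' s'"
      "k' \<le> d" "t' \<le> 6 * d + 1" "represents n s' ((?step ^^ d) (i', j', b'))" by blast
    have "exec n (quantile F) x (While stair_guard stair_body) s (Suc (t + t')) (1 + k') s'"
      by (rule exec.WhileTrue) (use guard True s1 s' in auto)
    then show ?thesis
      using s' s1(2) st by (intro exI[of _ "Suc (t + t')"] exI[of _ "1 + k'"] exI[of _ s'])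
        (simp add: funpow_swap1)
  next
    case False
    \<comment> \<open>The loop may stop with fuel left; the remaining iterations of the abstract
      step then leave the state fixed.\<close>
    have "?step (i, j, b) = (i, j, b)"
      using False by (auto simp: stair_step_def)
    then have "(?step ^^ t) (i, j, b) = (i, j, b)" for t
      by (induction t) auto
    moreover have "exec n (quantile F) x (While stair_guard stair_body) s 1 0 s"
      by (rule exec.WhileFalse) (use guard False in simp)
    ultimately show ?thesis
      using Suc.prems by (intro exI[of _ 1] exI[of _ 0] exI[of _ s]) (auto simp del: funpow.simps)
  qed
qed

abbreviation final_box :: "nat \<Rightarrow> real measure \<Rightarrow> (nat \<Rightarrow> real) \<Rightarrow> nat" where
  "final_box n F x \<equiv>
     staircase_box n (n - cube_scale n * cube_scale n) (cube_scale n * cube_scale n) (threshold n F) x"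

lemma runs_staircase:
  assumes F: "nonneg_continuous_dist F" and n: "1 \<le> n"
  shows "\<exists>t k. runs staircase n F x t k (final_box n F x) \<and> k \<le> n \<and> t \<le> 8 * n + 4"
proof -
  let ?s1 = "nupd (NConst 1) (nval (R 0) (initial n)) (initial n)"
  let ?s2 = "nupd (NConst 0) (nval (NConst 0) ?s1) ?s1"
  have "\<exists>t s'. exec n (quantile F) x scale_loop ?s2 t 0 s' \<and> t \<le> 2 * cube_scale n + 1 \<and>
      nreg s' = (nreg ?s2)(2 := cube_scale n)"
    by (rule exec_scale_loop) (auto simp: nupd_def initial_def)
  then obtain t1 s3 where s3: "exec n (quantile F) x scale_loop ?s2 t1 0 s3"
    "t1 \<le> 2 * cube_scale n + 1" "nreg s3 = (nreg ?s2)(2 := cube_scale n)" by blast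
  have "represents n s3 (0, 0, 0)"
    by (simp add: represents_def s3(3) nupd_def initial_def)
  then obtain t2 k2 s4 where s4: "exec n (quantile F) x (While stair_guard stair_body) s3 t2 k2 s4"
    "k2 \<le> n" "t2 \<le> 6 * n + 1" "represents n s4
      ((program_step n F x ^^ n) (0, 0, 0))"
    using exec_stair_loop[OF F n, of s3 0 0 0 n x] by auto
  have "exec n (quantile F) x staircase (initial n) (1 + (1 + (t1 + t2))) (0 + (0 + (0 + k2))) s4"
    unfolding staircase_def
    by (rule exec.Seq[OF exec.NAssign exec.Seq[OF exec.NAssign exec.Seq[OF s3(1) s4(1)]]])
  moreover have "nreg s4 0 = final_box n F x"
    using s4(4) by (auto simp: represents_def staircase_box_def split: prod.splits)
  moreover have "1 + (1 + (t1 + t2)) \<le> 8 * n + 4"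
    using s3(2) s4(3) scale_sq_less(2)[OF n] by simp
  ultimately show ?thesis
    using s4(2) by (intro exI[of _ "1 + (1 + (t1 + t2))"] exI[of _ k2]) auto
qed

lemma chosen_box_staircase:
  assumes "nonneg_continuous_dist F" "1 \<le> n"
  shows "chosen_box staircase n F x = final_box n F x"
  unfolding chosen_box_def
proof (rule the_equality)
  show "\<exists>t k. runs staircase n F x t k (final_box n F x)"
    using runs_staircase[OF assms] by blast
  then show "\<And>b. \<exists>t k. runs staircase n F x t k b \<Longrightarrow> b = final_box n F x"
    using exec_deterministic by metis
qed

lemma threshold_testing_algorithm_staircase: "threshold_testing_algorithm staircase"
  unfolding threshold_testing_algorithm_def
proof (intro allI impI)
  fix n F x assume "1 \<le> (n :: nat)" "nonneg_continuous_dist F"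
  then show "\<exists>t k b. runs staircase n F x t k b \<and> k \<le> n \<and> b < n"
    using runs_staircase[of F n x] staircase_box_less[of n "n - cube_scale n * cube_scale n"] by fastforce
qed

lemma efficient_staircase: "efficient staircase"
  unfolding efficient_def
proof (intro exI[of _ "[:4, 8:]"] allI impI)
  fix n F x assume "1 \<le> (n :: nat)" "nonneg_continuous_dist F"
  then show "\<exists>t k b. runs staircase n F x t k b \<and> t \<le> poly [:4, 8:] n"
    using runs_staircase[of F n x] by (fastforce simp: algebra_simps)
qed

section \<open>The competitive ratio\<close>

lemma thresholds_staircase:
  assumes F: "nonneg_continuous_dist F" and n: "1 \<le> n" and k: "1 \<le> cube_scale n"
  shows "thresholds F (cube_scale n * cube_scale n) (threshold n F) (quantile_level n)"
proof -
  interpret real_distribution F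
    using F by (simp add: nonneg_continuous_dist_def)
  have cdf: "cdf F (threshold n F j) = quantile_level n j" if "j < cube_scale n * cube_scale n" for j
    unfolding threshold_def
    using cdf_quantile(1)[OF F] quantile_level_bounds[OF n that] by auto
  show ?thesis
  proof
    show "AE y in F. 0 \<le> y" "integrable F (\<lambda>y. y)"
      using F by (auto simp: nonneg_continuous_dist_def)
    \<comment> \<open>Thresholds in the wrong order would reverse the levels, by monotonicity of the
      distribution function, but the levels increase strictly.\<close>
    show "mono_on {..<cube_scale n * cube_scale n} (threshold n F)"
    proof (rule mono_onI, rule ccontr)
      fix i j
      assume ij: "i \<in> {..<cube_scale n * cube_scale n}" "j \<in> {..<cube_scale n * cube_scale n}" "i \<le> j"
        and "\<not> threshold n F i \<le> threshold n F j"
      then have less: "threshold n F j < threshold n F i" by simp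
      then have "i < j"
        using ij(3) by (cases "i = j") auto
      then have "quantile_level n i < quantile_level n j"
        using n k by (auto simp: quantile_level_def intro!: divide_strict_right_mono)
      moreover have "cdf F (threshold n F j) \<le> cdf F (threshold n F i)"
        using less by (intro cdf_nondecreasing) simp
      ultimately show False
        using cdf ij by simp
    qed
    show "prob {..<threshold n F j} = quantile_level n j"
      if "j < cube_scale n * cube_scale n" for j
    proof -
      \<comment> \<open>Continuity excludes an atom at the threshold, so the mass strictly below it
        equals the value of the distribution function.\<close>
      have "isCont (cdf F) (threshold n F j)"
        using F by (auto simp: nonneg_continuous_dist_def continuous_on_eq_continuous_at)
      then have "prob {threshold n F j} = 0"
        by (simp add: isCont_cdf)
      moreover have "prob ({..<threshold n F j} \<union> {threshold n F j}) =
          prob {..<threshold n F j} + prob {threshold n F j}"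
        by (intro finite_measure_Union) auto
      moreover have "{..<threshold n F j} \<union> {threshold n F j} = {..threshold n F j}"
        by auto
      ultimately show ?thesis
        using cdf[OF that] by (simp add: cdf_def)
    qed
    show "quantile_level n (cube_scale n * cube_scale n) = 1"
      by (simp add: quantile_level_def)
    show "0 < cube_scale n * cube_scale n"
      using k by simp
  qed
qed

section \<open>Estimates for the quantile levels\<close>

lemma quantile_level_Suc:
  "quantile_level n j = quantile_level n (Suc j) - 1 / (real (cube_scale n) * real n)"
  by (simp add: quantile_level_def diff_divide_distrib add_divide_distrib)

lemma quantile_level_0:
  assumes "1 \<le> cube_scale n"
  shows "quantile_level n 0 = 1 - real (cube_scale n) / real n"
  using assms by (simp add: quantile_level_def)

text \<open>This bounds the loss from other boxes sharing the slice of the maximum. All levels are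
  at least \<open>1 / 2\<close>, so one slice lowers the level by a factor of at least
  \<open>1 - 2 / (k * n)\<close>, and Bernoulli's inequality handles the power.\<close>

lemma quantile_level_power_ratio:
  assumes n: "1 \<le> n" and k: "2 \<le> cube_scale n"
  shows "(1 - 2 / real (cube_scale n)) * quantile_level n (Suc j) ^ (n - 1) \<le>
    quantile_level n j ^ (n - 1)"
proof -
  define k where "k = real (cube_scale n)"
  define r where "r = quantile_level n (Suc j)"
  have k2: "2 \<le> k"
    using k by (simp add: k_def)
  have "2 * cube_scale n \<le> n"
    using mult_right_mono[OF k, of "cube_scale n"] scale_sq_less(1)[OF n] by linarith
  then have kn: "2 * k \<le> real n"
    unfolding k_def by linarith
  then have "1 / 2 \<le> quantile_level n 0"
    using n k by (subst quantile_level_0) (auto simp: k_def field_simps)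
  also have "\<dots> \<le> r"
    unfolding r_def by (rule quantile_level_mono) simp
  finally have r: "1 / 2 \<le> r" .
  \<comment> \<open>The numerator 2 turns the absolute decrease \<open>1 / (k * n)\<close> into a
    relative one, using \<open>r \<ge> 1 / 2\<close>.\<close>
  define d where "d = 2 / (k * real n)"
  have kn1: "2 \<le> k * real n"
    using mult_mono[OF k2, of 1 "real n"] n k2 by simp
  have d: "0 \<le> d" "d \<le> 1"
    using kn1 by (auto simp: d_def)
  have "real (n - 1) * d \<le> real n * d"
    using d(1) by (intro mult_right_mono) auto
  also have "\<dots> = 2 / k"
    using n by (simp add: d_def)
  finally have "1 - 2 / k \<le> 1 + real (n - 1) * (- d)"
    by simp
  also have "\<dots> \<le> (1 + (- d)) ^ (n - 1)"
    by (rule Bernoulli_inequality) (use d in simp)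
  finally have "(1 - 2 / k) * r ^ (n - 1) \<le> (1 + (- d)) ^ (n - 1) * r ^ (n - 1)"
    using r by (intro mult_right_mono) auto
  also have "\<dots> = (r - r * d) ^ (n - 1)"
    by (simp add: algebra_simps flip: power_mult_distrib)
  also have "\<dots> \<le> quantile_level n j ^ (n - 1)"
  proof (rule power_mono)
    have "d / 2 \<le> r * d"
      using mult_right_mono[OF r d(1)] by simp
    then show "r - r * d \<le> quantile_level n j"
      by (subst quantile_level_Suc) (simp add: r_def d_def k_def)
    show "0 \<le> r - r * d"
      using r d mult_left_le[of d r] by simp
  qed
  finally show ?thesis
    by (simp add: k_def r_def)
qed

text \<open>For \<open>y = k / n\<close>, \<open>(1 - y) ^ n * (1 + y) ^ n \<le> 1\<close>, while
  Bernoulli's inequality gives \<open>(1 + y) ^ n \<ge> 1 + k\<close>.\<close>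

lemma quantile_level_0_power_le:
  assumes n: "1 \<le> n" and k: "1 \<le> cube_scale n"
  shows "quantile_level n 0 ^ n \<le> 1 / (1 + real (cube_scale n))"
proof -
  define y where "y = real (cube_scale n) / real n"
  have y: "0 \<le> y" "y \<le> 1"
    using scale_sq_less(2)[OF n] n by (auto simp: y_def)
  have "(1 - y) ^ n * (1 + real n * y) \<le> (1 - y) ^ n * (1 + y) ^ n"
    using y by (intro mult_left_mono Bernoulli_inequality) auto
  also have "\<dots> = (1 - y * y) ^ n"
    by (simp add: algebra_simps flip: power_mult_distrib)
  also have "\<dots> \<le> 1"
    using y mult_le_one[of y y] by (intro power_le_one) auto
  finally have "(1 - y) ^ n * (1 + real (cube_scale n)) \<le> 1"
    using n by (simp add: y_def)
  then show ?thesis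
    unfolding quantile_level_0[OF k] y_def by (simp add: pos_le_divide_eq)
qed

text \<open>The factors account for the untested boxes, for collisions within a slice, and for a
  maximum below the lowest threshold.\<close>

definition ratio :: "nat \<Rightarrow> real" where
  "ratio k = (1 - 1 / real k) * (1 - 2 / real k) * (1 - 1 / (1 + real k))"

text \<open>The third factor vanishes at 0, where division by zero yields 0 in the others, the first
  at 1 and the second at 2. For such scales a nonnegative payoff is enough.\<close>

lemma ratio_small: "k \<le> 2 \<Longrightarrow> ratio k = 0"
  by (auto simp: ratio_def numeral_2_eq_2 le_Suc_eq)

lemma ratio_tendsto: "ratio \<longlonglongrightarrow> 1"
proof -
  have "(\<lambda>k. 1 / (1 + real k)) \<longlonglongrightarrow> 0"
    using LIMSEQ_Suc[OF lim_const_over_n[of "1 :: real"]] by (simp add: add.commute)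
  then have "ratio \<longlonglongrightarrow> (1 - 0) * (1 - 0) * (1 - 0)"
    unfolding ratio_def by (intro tendsto_mult tendsto_diff tendsto_const lim_const_over_n)
  then show ?thesis by simp
qed

lemma filterlim_cube_scale: "filterlim cube_scale at_top sequentially"
  unfolding filterlim_at_top
proof
  fix z :: nat
  show "eventually (\<lambda>n. z \<le> cube_scale n) sequentially"
    using eventually_gt_at_top[of "z ^ 3"]
  proof eventually_elim
    case (elim n)
    show ?case
    proof (rule ccontr)
      assume "\<not> z \<le> cube_scale n"
      then have "Suc (cube_scale n) ^ 3 \<le> z ^ 3"
        by (intro power_mono) auto
      with le_scale[of n] elim show False by simp
    qed
  qed
qed

lemma competitive_staircase:
  assumes F: "nonneg_continuous_dist F" and n: "1 \<le> n"
  shows "competitive (ratio (cube_scale n)) staircase n F"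
proof -
  let ?M = "cube_scale n * cube_scale n"
  define ES where "ES = (LINT x|(\<Pi>\<^sub>M i\<in>{..<n}. F). x (final_box n F x))"
  define EM where "EM = (LINT x|(\<Pi>\<^sub>M i\<in>{..<n}. F). Max (x ` {..<n}))"
  interpret prob: prob_space F
    using F by (simp add: nonneg_continuous_dist_def real_distribution_def)
  have "AE x in (\<Pi>\<^sub>M i\<in>{..<n}. F). \<forall>i\<in>{..<n}. 0 \<le> x i"
    using F by (intro AE_finite_allI AE_PiM_component)
      (auto simp: nonneg_continuous_dist_def prob.prob_space_axioms)
  then have nonneg: "AE x in (\<Pi>\<^sub>M i\<in>{..<n}. F). \<forall>i<n. 0 \<le> x i"
    by (simp only: Ball_def lessThan_iff)
  have ES: "0 \<le> ES"
    unfolding ES_def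
  proof (rule integral_nonneg_AE)
    show "AE x in (\<Pi>\<^sub>M i\<in>{..<n}. F). 0 \<le> x (final_box n F x)"
      using nonneg by eventually_elim (use n staircase_box_less in auto)
  qed
  have "ratio (cube_scale n) * EM \<le> ES"
  proof (cases "cube_scale n \<le> 2")
    case False
    define k where "k = real (cube_scale n)"
    have k: "3 \<le> k" "1 \<le> cube_scale n" "2 \<le> cube_scale n"
      using False by (auto simp: k_def)
    interpret thresholds F ?M "threshold n F" "quantile_level n"
      by (rule thresholds_staircase[OF F n k(2)])
    \<comment> \<open>In \<open>S\<close> the other boxes lie below the lower end of the slice, in
      \<open>T\<close> below its upper end. Comparing the sums slice by slice is the conditioning on
      the slice of the maximum.\<close>
    define S where "S = (\<Sum>b<?M. bucket_mass b * quantile_level n b ^ (n - 1))"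
    define T where "T = (\<Sum>b<?M. bucket_mass b * quantile_level n (Suc b) ^ (n - 1))"
    have EM: "0 \<le> EM"
      unfolding EM_def
    proof (rule integral_nonneg_AE)
      show "AE x in (\<Pi>\<^sub>M i\<in>{..<n}. F). 0 \<le> Max (x ` {..<n})"
        using nonneg by eventually_elim (use Max_box[OF n] in metis)
    qed
    have M: "?M \<le> n"
      using scale_sq_less(1)[OF n] by simp
    have "(1 - 1 / (1 + k)) * EM \<le> (1 - quantile_level n 0 ^ n) * EM"
      using EM quantile_level_0_power_le[OF n k(2)] by (intro mult_right_mono) (auto simp: k_def)
    also have "\<dots> \<le> real n * T"
      unfolding EM_def T_def by (rule expectation_Max_le[OF n])
    finally have 1: "(1 - 1 / (1 + k)) * EM \<le> real n * T" .
    have "bucket_mass b * ((1 - 2 / k) * quantile_level n (Suc b) ^ (n - 1)) \<le>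
        bucket_mass b * quantile_level n b ^ (n - 1)" for b
      unfolding k_def
      by (intro mult_left_mono bucket_mass_nonneg quantile_level_power_ratio n k(3))
    then have 2: "(1 - 2 / k) * T \<le> S"
      unfolding S_def T_def sum_distrib_left by (intro sum_mono) (simp add: mult_ac)
    have S: "0 \<le> S"
      unfolding S_def using quantile_level_bounds[OF n]
      by (intro sum_nonneg mult_nonneg_nonneg bucket_mass_nonneg zero_le_power)
        (auto intro: less_imp_le)
    \<comment> \<open>From \<open>k ^ 3 \<le> n\<close> follows \<open>k * k \<le> n / k\<close>,
      the number of boxes given up.\<close>
    have "real (cube_scale n ^ 3) \<le> real n"
      using scale_cube_less[OF n] by (simp only: of_nat_le_iff)
    then have "real n * (1 - 1 / k) \<le> real (n - ?M)"
      using M k by (simp add: k_def of_nat_diff field_simps power3_eq_cube)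
    then have 3: "real n * (1 - 1 / k) * S \<le> real (n - ?M) * S"
      using S by (rule mult_right_mono)
    also have "\<dots> \<le> ES"
      unfolding S_def ES_def by (rule expectation_staircase_ge) (use M n in auto)
    finally have 3: "real n * (1 - 1 / k) * S \<le> ES" .
    have k12: "0 \<le> 1 - 1 / k" "0 \<le> 1 - 2 / k"
      using k by auto
    have "ratio (cube_scale n) * EM = (1 - 1 / k) * (1 - 2 / k) * ((1 - 1 / (1 + k)) * EM)"
      by (simp add: ratio_def k_def)
    also have "\<dots> \<le> (1 - 1 / k) * (1 - 2 / k) * (real n * T)"
      using k12 by (intro mult_left_mono 1) auto
    also have "\<dots> = real n * (1 - 1 / k) * ((1 - 2 / k) * T)"
      by simp
    also have "\<dots> \<le> real n * (1 - 1 / k) * S"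
      using k12 by (intro mult_left_mono 2) auto
    finally show ?thesis
      using 3 by simp
  qed (simp add: ratio_small ES)
  then show ?thesis
    by (simp add: competitive_def chosen_box_staircase[OF F n] ES_def EM_def)
qed

theorem theorem9:
  shows "\<exists>(c :: prog) (\<epsilon> :: nat \<Rightarrow> real).
    threshold_testing_algorithm c \<and> efficient c \<and> \<epsilon> \<longlonglongrightarrow> 0 \<and>
    (\<forall>n\<ge>1. \<forall>F. nonneg_continuous_dist F \<longrightarrow> competitive (1 - \<epsilon> n) c n F)"
proof (intro exI conjI allI impI)
  show "threshold_testing_algorithm staircase"
    by (rule threshold_testing_algorithm_staircase)
  show "efficient staircase"
    by (rule efficient_staircase)
  have "(\<lambda>n. 1 - ratio (cube_scale n)) \<longlonglongrightarrow> 1 - 1"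
    by (intro tendsto_diff tendsto_const filterlim_compose[OF ratio_tendsto filterlim_cube_scale])
  then show "(\<lambda>n. 1 - ratio (cube_scale n)) \<longlonglongrightarrow> 0"
    by simp
  show "competitive (1 - (1 - ratio (cube_scale n))) staircase n F"
    if "1 \<le> n" "nonneg_continuous_dist F" for n F
    using competitive_staircase that by simp
qed

end
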